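(* Let $T$ be Plotkin's tie. If $D$ is an FS-domain, then the Scott function space $[D\to T]$ is continuous.
   Context: A dcpo is a poset in which every directed (in particular nonempty) subset has a supremum. A map between dcpos is Scott-continuous if it is monotone and preserves suprema of directed subsets. For dcpos $D,E$, the Scott function space $[D\to E]$ is the dcpo of all Scott-continuous maps $D\to E$ with the pointwise order; directed suprema are computed pointwise. In a dcpo $D$, $a\ll x$ ($a$ is way below $x$) if for every directed $A\subseteq D$ with $x\le\bigvee A$ there is $y\in A$ with $a\le y$. A dcpo $D$ is continuous if for every $x\in D$ the set $\{a\in D: a\ll x\}$ is directed and has supremum $x$. A Scott-continuous map $f:D\to D$ is finitely separated from the identity if there is a finite set $M\subseteq D$ such that for every $x\in D$ there is $m\in M$ with $f(x)\le m\le x$. An FS-domain is a continuous dcpo $D$ for which there is a directed family (pointwise order) $(f_i)_{i\in I}$ of Scott-continuous maps $D\to D$, each finitely separated from the identity, with $x=\bigvee_{i\in I}f_i(x)$ for every $x\in D$. Plotkin's tie is the poset $T=\{\bot,\top\}\cup\{a_n,b_n:n\ge 1\}$ (all listed elements distinct) with $\bot\le x\le\top$ for all $x\in T$ and, for $u,v\in\{a,b\}$, $u_m\le v_n$ if and only if $m<n$ or ($m=n$ and $u_m=v_n$). *)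

theory Defs
  imports "HOL-Library.Lub_Glb" "HOL-Library.FuncSet"
begin

text \<open>
  A poset is given by a carrier set \<open>D\<close> inside a type of class \<open>order\<close>, with the inherited order.
  The type is arbitrary, so this covers all posets, the empty one included.
  Suprema are taken relative to the carrier: \<open>isLub D A s\<close> says that \<open>s\<close> lies in \<open>D\<close> and is
  the least among the upper bounds of \<open>A\<close> that lie in \<open>D\<close>.
\<close>

definition directed :: "'a::order set \<Rightarrow> bool" where
  "directed A \<longleftrightarrow> A \<noteq> {} \<and> (\<forall>x\<in>A. \<forall>y\<in>A. \<exists>z\<in>A. x \<le> z \<and> y \<le> z)"

definition dcpo :: "'a::order set \<Rightarrow> bool" where
  "dcpo D \<longleftrightarrow> (\<forall>A\<subseteq>D. directed A \<longrightarrow> (\<exists>s. isLub D A s))"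

definition scott_continuous ::
  "'a::order set \<Rightarrow> 'b::order set \<Rightarrow> ('a \<Rightarrow> 'b) \<Rightarrow> bool" where
  "scott_continuous D E f \<longleftrightarrow> f \<in> D \<rightarrow> E \<and> mono_on D f \<and>
     (\<forall>A s. A \<subseteq> D \<and> directed A \<and> isLub D A s \<longrightarrow> isLub E (f ` A) (f s))"

text \<open>
  Maps \<open>D \<rightarrow> E\<close> are represented by functions that are \<open>undefined\<close> outside \<open>D\<close>; the function order
  of the library then restricts to the pointwise order over \<open>D\<close>, see \<open>scott_space_le_iff\<close>.
\<close>

definition scott_space :: "'a::order set \<Rightarrow> 'b::order set \<Rightarrow> ('a \<Rightarrow> 'b) set" where
  "scott_space D E = {f \<in> extensional D. scott_continuous D E f}"

lemma scott_space_le_iff: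
  assumes "f \<in> scott_space D E" "g \<in> scott_space D E"
  shows "f \<le> g \<longleftrightarrow> (\<forall>x\<in>D. f x \<le> g x)"
proof
  assume le: "\<forall>x\<in>D. f x \<le> g x"
  show "f \<le> g"
  proof (rule le_funI)
    fix x
    show "f x \<le> g x"
      using assms le by (cases "x \<in> D") (auto simp: scott_space_def extensional_def)
  qed
qed (simp add: le_funD)

definition way_below :: "'a::order set \<Rightarrow> 'a \<Rightarrow> 'a \<Rightarrow> bool" where
  "way_below D a x \<longleftrightarrow> a \<in> D \<and> x \<in> D \<and>
     (\<forall>A s. A \<subseteq> D \<and> directed A \<and> isLub D A s \<and> x \<le> s \<longrightarrow> (\<exists>y\<in>A. a \<le> y))"

definition continuous_dcpo :: "'a::order set \<Rightarrow> bool" where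
  "continuous_dcpo D \<longleftrightarrow> dcpo D \<and>
     (\<forall>x\<in>D. directed {a \<in> D. way_below D a x} \<and> isLub D {a \<in> D. way_below D a x} x)"

definition finitely_separated :: "'a::order set \<Rightarrow> ('a \<Rightarrow> 'a) \<Rightarrow> bool" where
  "finitely_separated D f \<longleftrightarrow>
     (\<exists>M\<subseteq>D. finite M \<and> (\<forall>x\<in>D. \<exists>m\<in>M. f x \<le> m \<and> m \<le> x))"

text \<open>The directed family of maps is given by its range \<open>F\<close>.\<close>

definition FS_domain :: "'a::order set \<Rightarrow> bool" where
  "FS_domain D \<longleftrightarrow> continuous_dcpo D \<and>
     (\<exists>F \<subseteq> scott_space D D. directed F \<and> (\<forall>f\<in>F. finitely_separated D f) \<and>
        (\<forall>x\<in>D. isLub D ((\<lambda>f. f x) ` F) x))"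

datatype tie_side = Side_a | Side_b

text \<open>
  \<open>Elem Side_a n\<close> and \<open>Elem Side_b n\<close> stand for $a_n$ and $b_n$. The type also contains the index
  \<open>n = 0\<close>, which the carrier \<open>plotkin_tie\<close> leaves out.
\<close>

datatype tie_elem = Bot | Top | Elem tie_side nat

instantiation tie_elem :: order
begin

definition less_eq_tie_elem :: "tie_elem \<Rightarrow> tie_elem \<Rightarrow> bool" where
  "x \<le> y \<longleftrightarrow> x = Bot \<or> y = Top \<or>
     (\<exists>u m v n. x = Elem u m \<and> y = Elem v n \<and> (m < n \<or> m = n \<and> x = y))"

definition less_tie_elem :: "tie_elem \<Rightarrow> tie_elem \<Rightarrow> bool" where
  "x < y \<longleftrightarrow> x \<le> y \<and> \<not> y \<le> x" for x y :: tie_elem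

instance
proof
  fix x y z :: tie_elem
  show "x < y \<longleftrightarrow> x \<le> y \<and> \<not> y \<le> x" by (rule less_tie_elem_def)
  show "x \<le> x" by (cases x) (auto simp: less_eq_tie_elem_def)
  show "x \<le> z" if "x \<le> y" "y \<le> z" using that by (auto simp: less_eq_tie_elem_def)
  show "x = y" if "x \<le> y" "y \<le> x" using that by (auto simp: less_eq_tie_elem_def)
qed

end

definition plotkin_tie :: "tie_elem set" where
  "plotkin_tie = {Bot, Top} \<union> {Elem u n | u n. n \<ge> 1}"

end

theory Submission
  imports Defs
begin

text \<open>
  Let \<open>g\<close> be a Scott-continuous map from \<open>D\<close> to Plotkin's tie \<open>T\<close>. If \<open>T\<close> were itself an
  FS-domain, the maps \<open>r \<circ> g \<circ> f\<close>, with \<open>r\<close> and \<open>f\<close> finitely separated from the identities of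
  \<open>T\<close> and \<open>D\<close>, would approximate \<open>g\<close>. There are not enough such \<open>r\<close>: a monotone map below
  the identity of \<open>T\<close> that fixes $a_n$ and $b_n$ fixes all later elements as well, hence is not
  finitely separated from the identity.

  The way out is a truncation \<open>cap N\<close> that keeps \<open>Bot\<close> and the elements of index at most \<open>N\<close> and sends
  the rest of \<open>T\<close> to $a_{N+1}$. It is Scott-continuous, and it fails to be below the identity
  only at $b_{N+1}$. This failure is harmless. If the finite set \<open>M\<close> separates \<open>f\<close> from the
  identity, then \<open>g\<close> has only finitely many values on \<open>M\<close>, so for all large \<open>N\<close> one has
  \<open>cap N (g m) \<le> g m\<close> for each \<open>m \<in> M\<close>. For \<open>f x \<le> m \<le> x\<close> this gives
  \<open>cap N (g (f x)) \<le> cap N (g m) \<le> g m \<le> g x\<close>. As \<open>cap N (g m)\<close> is compact and \<open>M\<close> is finite,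
  \<open>cap N \<circ> g \<circ> f\<close> is even way below \<open>g\<close> (\<open>capped_approximant_way_below\<close>).

  These approximants have supremum \<open>g\<close>: for growing \<open>N\<close>, the values \<open>cap N t\<close> are eventually
  equal to \<open>t\<close> if \<open>t \<noteq> Top\<close> and increase to \<open>t\<close> if \<open>t = Top\<close>, and \<open>g\<close> preserves the supremum
  \<open>x\<close> of the \<open>f x\<close>. That they are directed is not
  visible from the formula, because \<open>cap N\<close> does not increase with \<open>N\<close>. It follows from the
  way-below relation: two approximants lie below a common \<open>g \<circ> f\<close>, and applying \<open>cap N\<close> for a
  large \<open>N\<close> leaves them unchanged and turns \<open>g \<circ> f\<close> into an approximant.
  A directed set of elements way below \<open>g\<close> with supremum \<open>g\<close> suffices for continuity at \<open>g\<close>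
  (\<open>directed_way_belowI\<close>).
\<close>

section \<open>Directed sets and suprema relative to a carrier\<close>

lemma isLub_iff:
  "isLub D A s \<longleftrightarrow> s \<in> D \<and> (\<forall>x\<in>A. x \<le> s) \<and> (\<forall>u\<in>D. (\<forall>x\<in>A. x \<le> u) \<longrightarrow> s \<le> u)"
  for s :: "'a::order"
  by (auto simp: isLub_def leastP_def isUb_def setle_def setge_def)

lemma isLub_unique_order: "isLub D A s \<Longrightarrow> isLub D A t \<Longrightarrow> s = t"
  for s :: "'a::order"
  by (simp add: isLub_iff order_antisym)

lemma directed_image:
  assumes "directed A" "\<And>x y. x \<in> A \<Longrightarrow> y \<in> A \<Longrightarrow> x \<le> y \<Longrightarrow> f x \<le> f y"
  shows "directed (f ` A)"
  using assms unfolding directed_def by (auto; metis)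

lemma directed_finite_choice:
  assumes "directed A" "finite M"
    and "\<And>m. m \<in> M \<Longrightarrow> \<exists>k\<in>A. P m k"
    and up: "\<And>m k l. m \<in> M \<Longrightarrow> P m k \<Longrightarrow> k \<in> A \<Longrightarrow> l \<in> A \<Longrightarrow> k \<le> l \<Longrightarrow> P m l"
  shows "\<exists>k\<in>A. \<forall>m\<in>M. P m k"
  using assms(2,3) up
proof (induction M)
  case empty
  then show ?case using assms(1) by (auto simp: directed_def)
next
  case (insert m M)
  have "\<exists>k\<in>A. \<forall>m\<in>M. P m k"
    by (rule insert.IH) (use insert.prems in \<open>blast+\<close>)
  then obtain k where k: "k \<in> A" "\<forall>m\<in>M. P m k" by blast
  obtain l where l: "l \<in> A" "P m l" using insert.prems(1) by blast
  obtain z where "z \<in> A" "k \<le> z" "l \<le> z"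
    using assms(1) k(1) l(1) unfolding directed_def by blast
  with k l insert.prems(2) show ?case by (intro bexI[of _ z]) blast+
qed

lemma way_below_imp_le: "way_below D a x \<Longrightarrow> a \<le> x"
  unfolding way_below_def
  by (auto simp: isLub_iff directed_def dest!: spec[of _ "{x}"])

lemma directed_way_belowI:
  assumes "x \<in> D" and H: "directed H" "isLub D H x" "\<And>h. h \<in> H \<Longrightarrow> way_below D h x"
  shows "directed {a \<in> D. way_below D a x} \<and> isLub D {a \<in> D. way_below D a x} x"
proof
  have sub: "H \<subseteq> {a \<in> D. way_below D a x}"
    using H(3) by (auto simp: way_below_def)
  have below: "\<exists>h\<in>H. a \<le> h" if "way_below D a x" for a
    using that H(1,2) sub unfolding way_below_def by blast
  show "directed {a \<in> D. way_below D a x}"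
    unfolding directed_def
  proof (intro conjI ballI)
    show "{a \<in> D. way_below D a x} \<noteq> {}"
      using H(1) sub by (auto simp: directed_def)
    fix a b assume "a \<in> {a \<in> D. way_below D a x}" "b \<in> {a \<in> D. way_below D a x}"
    then obtain h k where "h \<in> H" "a \<le> h" "k \<in> H" "b \<le> k" using below by blast
    moreover from this obtain l where "l \<in> H" "h \<le> l" "k \<le> l"
      using H(1) unfolding directed_def by blast
    ultimately show "\<exists>z\<in>{a \<in> D. way_below D a x}. a \<le> z \<and> b \<le> z"
      using sub by (intro bexI[of _ l]) (auto intro: order_trans)
  qed
  show "isLub D {a \<in> D. way_below D a x} x"
    using H(2) sub way_below_imp_le \<open>x \<in> D\<close> unfolding isLub_iff by blast
qed

section \<open>Scott-continuous maps\<close>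

lemma scott_spaceD:
  assumes "f \<in> scott_space D E"
  shows scott_space_closed: "x \<in> D \<Longrightarrow> f x \<in> E"
    and scott_space_mono: "x \<in> D \<Longrightarrow> y \<in> D \<Longrightarrow> x \<le> y \<Longrightarrow> f x \<le> f y"
    and scott_space_isLub: "A \<subseteq> D \<Longrightarrow> directed A \<Longrightarrow> isLub D A s \<Longrightarrow> isLub E (f ` A) (f s)"
  using assms by (auto simp: scott_space_def scott_continuous_def mono_on_def)

lemma scott_spaceI:
  assumes "f \<in> extensional D" "\<And>x. x \<in> D \<Longrightarrow> f x \<in> E"
    and "\<And>x y. x \<in> D \<Longrightarrow> y \<in> D \<Longrightarrow> x \<le> y \<Longrightarrow> f x \<le> f y"
    and "\<And>A s. A \<subseteq> D \<Longrightarrow> directed A \<Longrightarrow> isLub D A s \<Longrightarrow> isLub E (f ` A) (f s)"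
  shows "f \<in> scott_space D E"
  using assms by (auto simp: scott_space_def scott_continuous_def mono_on_def)

lemma scott_space_compose:
  assumes g: "g \<in> scott_space E E'" and f: "f \<in> scott_space D E"
  shows "restrict (\<lambda>x. g (f x)) D \<in> scott_space D E'"
proof (rule scott_spaceI)
  fix A s assume A: "A \<subseteq> D" "directed A" "isLub D A s"
  have "isLub E (f ` A) (f s)" using f A by (rule scott_space_isLub)
  moreover have "directed (f ` A)"
    using A(1,2) scott_space_mono[OF f] by (intro directed_image) auto
  moreover have "f ` A \<subseteq> E" using scott_space_closed[OF f] A(1) by auto
  ultimately have "isLub E' (g ` f ` A) (g (f s))" by (intro scott_space_isLub[OF g])
  moreover have "restrict (\<lambda>x. g (f x)) D ` A = g ` f ` A"
    using A(1) by (auto simp: image_iff subset_iff)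
  moreover have "s \<in> D" using A(3) by (simp add: isLub_iff)
  ultimately show "isLub E' (restrict (\<lambda>x. g (f x)) D ` A) (restrict (\<lambda>x. g (f x)) D s)"
    by simp
qed (use scott_space_closed[OF g] scott_space_closed[OF f]
      scott_space_mono[OF g] scott_space_mono[OF f] in auto)

lemma isLub_scott_spaceI:
  assumes H: "H \<subseteq> scott_space D E" and s: "s \<in> scott_space D E"
    and pt: "\<And>x. x \<in> D \<Longrightarrow> isLub E ((\<lambda>h. h x) ` H) (s x)"
  shows "isLub (scott_space D E) H s"
  unfolding isLub_iff
proof (intro conjI ballI impI s)
  show "h \<le> s" if "h \<in> H" for h
    using that H s pt by (auto simp: scott_space_le_iff subset_iff isLub_iff)
  show "s \<le> u" if u: "u \<in> scott_space D E" and ub: "\<forall>h\<in>H. h \<le> u" for u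
  proof -
    have "s x \<le> u x" if "x \<in> D" for x
      using pt[OF that] scott_space_closed[OF u that] ub by (auto simp: isLub_iff le_fun_def)
    then show ?thesis using u s by (simp add: scott_space_le_iff)
  qed
qed

lemma directed_eval: "directed H \<Longrightarrow> directed ((\<lambda>h. h x) ` H)"
  by (rule directed_image) (auto simp: le_fun_def)

lemma scott_space_pointwise_lub:
  assumes "dcpo E" and H: "H \<subseteq> scott_space D E" "directed H"
  obtains s where "s \<in> scott_space D E" "\<And>x. x \<in> D \<Longrightarrow> isLub E ((\<lambda>h. h x) ` H) (s x)"
proof -
  have "\<exists>t. isLub E ((\<lambda>h. h x) ` H) t" if "x \<in> D" for x
  proof -
    have "(\<lambda>h. h x) ` H \<subseteq> E" using H(1) that scott_space_closed by blast
    then show ?thesis using assms(1) directed_eval[OF H(2)] unfolding dcpo_def by blast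
  qed
  then obtain t where t: "isLub E ((\<lambda>h. h x) ` H) (t x)" if "x \<in> D" for x by metis
  define s where "s = restrict t D"
  have s: "isLub E ((\<lambda>h. h x) ` H) (s x)" if "x \<in> D" for x
    using t[OF that] that by (simp add: s_def)
  have sE: "s x \<in> E" if "x \<in> D" for x
    using s[OF that] by (simp add: isLub_iff)
  have le_s: "h x \<le> s x" if "h \<in> H" "x \<in> D" for h x
    using s[OF that(2)] that(1) by (auto simp: isLub_iff)
  have s_le: "s x \<le> u" if "x \<in> D" "u \<in> E" "\<And>h. h \<in> H \<Longrightarrow> h x \<le> u" for x u
    using s[OF that(1)] that by (auto simp: isLub_iff)
  have mono: "s x \<le> s y" if "x \<in> D" "y \<in> D" "x \<le> y" for x y
  proof (rule s_le)
    show "h x \<le> s y" if "h \<in> H" for h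
      using that \<open>x \<in> D\<close> \<open>y \<in> D\<close> \<open>x \<le> y\<close> H(1) le_s[of h y] scott_space_mono[of h D E x y]
      by (meson order_trans subsetD)
  qed (use that sE in auto)
  have "s \<in> scott_space D E"
  proof (rule scott_spaceI)
    fix A a assume A: "A \<subseteq> D" "directed A" "isLub D A a"
    then have a: "a \<in> D" "\<And>x. x \<in> A \<Longrightarrow> x \<le> a" by (auto simp: isLub_iff)
    show "isLub E (s ` A) (s a)"
      unfolding isLub_iff
    proof (intro conjI ballI impI)
      show "s a \<in> E" using sE a by blast
      show "y \<le> s a" if "y \<in> s ` A" for y
        using that A(1) a mono by auto
      fix u assume u: "u \<in> E" "\<forall>y\<in>s ` A. y \<le> u"
      show "s a \<le> u"
      proof (rule s_le[OF a(1) u(1)])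
        fix h assume h: "h \<in> H"
        have "isLub E (h ` A) (h a)"
          using scott_space_isLub A H(1) h by blast
        moreover have "h x \<le> u" if "x \<in> A" for x
          using le_s[OF h, of x] u(2) A(1) that by (meson image_eqI order_trans subsetD)
        ultimately show "h a \<le> u" using u(1) by (auto simp: isLub_iff)
      qed
    qed
  qed (use sE mono in \<open>auto simp: s_def\<close>)
  then show thesis using s that by blast
qed

lemma dcpo_scott_space: "dcpo E \<Longrightarrow> dcpo (scott_space D E)"
  unfolding dcpo_def[of "scott_space D E"]
  by (metis scott_space_pointwise_lub isLub_scott_spaceI)

text \<open>
  Suprema being unique, an abstractly given supremum is the pointwise one. The way-below relation
  of a function space quantifies over the abstract suprema.
\<close>

lemma isLub_scott_spaceD:
  assumes "dcpo E" "H \<subseteq> scott_space D E" "directed H" "isLub (scott_space D E) H s" "x \<in> D"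
  shows "isLub E ((\<lambda>h. h x) ` H) (s x)"
proof -
  obtain t where "t \<in> scott_space D E" "\<And>x. x \<in> D \<Longrightarrow> isLub E ((\<lambda>h. h x) ` H) (t x)"
    using scott_space_pointwise_lub[OF assms(1-3)] by blast
  moreover from this have "s = t"
    using isLub_scott_spaceI[OF assms(2)] assms(4) isLub_unique_order by blast
  ultimately show ?thesis using assms(5) by simp
qed

section \<open>Directed sets in Plotkin's tie\<close>

text \<open>
  The elements that are not above a given $u_n$ are among \<open>Bot\<close> and the finitely many elements
  of index at most \<open>n\<close>, so a directed set that avoids the elements above $u_n$ is finite.
\<close>

lemma tie_directed_cases:
  assumes A: "directed A"
  obtains (greatest) y where "y \<in> A" "\<And>x. x \<in> A \<Longrightarrow> x \<le> y"
  | (unbounded) "\<And>u n. \<exists>y\<in>A. Elem u n \<le> y"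
proof (cases "\<forall>u n. \<exists>y\<in>A. Elem u n \<le> y")
  case True
  then show ?thesis using unbounded by blast
next
  case False
  then obtain u n where un: "\<And>y. y \<in> A \<Longrightarrow> \<not> Elem u n \<le> y" by blast
  have "A \<subseteq> insert Bot (case_prod Elem ` ({Side_a, Side_b} \<times> {..n}))"
  proof
    fix y assume "y \<in> A"
    then show "y \<in> insert Bot (case_prod Elem ` ({Side_a, Side_b} \<times> {..n}))"
    proof (cases y)
      case (Elem v m)
      then have "m \<le> n" using un[OF \<open>y \<in> A\<close>] by (auto simp: less_eq_tie_elem_def)
      moreover have "v \<in> {Side_a, Side_b}" by (cases v) auto
      ultimately show ?thesis using Elem by force
    qed (use un in \<open>auto simp: less_eq_tie_elem_def\<close>)
  qed
  then have "finite A" by (rule finite_subset) auto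
  then have "\<exists>y\<in>A. \<forall>x\<in>A. x \<le> y"
    by (intro directed_finite_choice[OF A]) auto
  then show ?thesis using greatest by blast
qed

lemma Elem_le_unbounded: "(\<And>n. n \<ge> n0 \<Longrightarrow> Elem u n \<le> t) \<Longrightarrow> t = Top"
proof (cases t)
  case (Elem v m)
  assume "\<And>n. n \<ge> n0 \<Longrightarrow> Elem u n \<le> t"
  from this[of "Suc (max n0 m)"] have "Elem u (Suc (max n0 m)) \<le> Elem v m" using Elem by simp
  then show ?thesis by (auto simp: less_eq_tie_elem_def)
qed (auto simp: less_eq_tie_elem_def)

lemma Top_in_plotkin_tie: "Top \<in> plotkin_tie"
  by (simp add: plotkin_tie_def)

lemma le_Top: "t \<le> Top"
  by (simp add: less_eq_tie_elem_def)

lemma dcpo_plotkin_tie: "dcpo plotkin_tie"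
  unfolding dcpo_def
proof (intro allI impI)
  fix A assume "A \<subseteq> plotkin_tie" "directed A"
  from \<open>directed A\<close> show "\<exists>s. isLub plotkin_tie A s"
  proof (cases rule: tie_directed_cases)
    case (greatest y)
    then have "isLub plotkin_tie A y" using \<open>A \<subseteq> plotkin_tie\<close> by (auto simp: isLub_iff)
    then show ?thesis ..
  next
    case unbounded
    have "Top \<le> u" if "\<forall>x\<in>A. x \<le> u" for u
      using that unbounded by (metis Elem_le_unbounded order_trans order_refl)
    then have "isLub plotkin_tie A Top"
      unfolding isLub_iff using Top_in_plotkin_tie le_Top by blast
    then show ?thesis ..
  qed
qed

lemma tie_compact:
  assumes "A \<subseteq> plotkin_tie" "directed A" "isLub plotkin_tie A s" "t \<le> s" "t \<noteq> Top"
  shows "\<exists>y\<in>A. t \<le> y"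
  using assms(2)
proof (cases rule: tie_directed_cases)
  case (greatest y)
  then have "s \<le> y" using assms(1,3) by (auto simp: isLub_iff)
  then show ?thesis using greatest(1) assms(4) by (meson order_trans)
next
  case unbounded
  then show ?thesis
    using assms(2,5) by (cases t) (auto simp: directed_def less_eq_tie_elem_def)
qed

section \<open>Truncations of Plotkin's tie\<close>

fun cap :: "nat \<Rightarrow> tie_elem \<Rightarrow> tie_elem" where
  "cap N Bot = Bot"
| "cap N Top = Elem Side_a (Suc N)"
| "cap N (Elem u n) = (if n \<le> N then Elem u n else Elem Side_a (Suc N))"

lemma cap_neq_Top: "cap N t \<noteq> Top"
  by (cases t) auto

lemma cap_mono: "s \<le> t \<Longrightarrow> cap N s \<le> cap N t"
  by (cases s; cases t) (auto simp: less_eq_tie_elem_def)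

lemma cap_cap: "N < N' \<Longrightarrow> cap N' (cap N t) = cap N t"
  by (cases t) auto

lemma cap_eventually_le: "\<exists>N0. \<forall>N\<ge>N0. cap N t \<le> t"
proof (cases t)
  case (Elem u n)
  then show ?thesis by (intro exI[of _ n]) auto
qed (auto simp: less_eq_tie_elem_def)

lemma le_if_cap_le:
  assumes "\<And>N. N \<ge> N0 \<Longrightarrow> cap N t \<le> u"
  shows "t \<le> u"
proof (cases t)
  case Bot
  then show ?thesis by (simp add: less_eq_tie_elem_def)
next
  case Top
  have "Elem Side_a n \<le> u" if "n \<ge> Suc N0" for n
    using that assms[of "n - 1"] Top by simp
  then have "u = Top" by (rule Elem_le_unbounded)
  then show ?thesis by (simp add: le_Top)
next
  case (Elem v n)
  then show ?thesis using assms[of "max N0 n"] by simp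
qed

text \<open>
  A directed supremum \<open>s\<close> is either attained or equal to \<open>Top\<close>; in the second case the directed
  set contains an element above $a_{N+1}$, which is truncated to $a_{N+1}$ just as \<open>Top\<close> is.
  So \<open>cap N s\<close> is always attained.
\<close>

lemma cap_scott_space: "restrict (cap N) plotkin_tie \<in> scott_space plotkin_tie plotkin_tie"
proof (rule scott_spaceI)
  have cl: "cap N t \<in> plotkin_tie" if "t \<in> plotkin_tie" for t
    using that by (cases t) (auto simp: plotkin_tie_def)
  show "restrict (cap N) plotkin_tie t \<in> plotkin_tie" if "t \<in> plotkin_tie" for t
    using that cl by simp
  fix A s assume A: "A \<subseteq> plotkin_tie" "directed A" "isLub plotkin_tie A s"
  then have s: "s \<in> plotkin_tie" "\<And>y. y \<in> A \<Longrightarrow> y \<le> s" by (auto simp: isLub_iff)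
  have "\<exists>y\<in>A. cap N s \<le> cap N y"
  proof (cases "s = Top")
    case True
    then obtain y where "y \<in> A" "cap N s \<le> y"
      using tie_compact[OF A le_Top[of "cap N s", folded True] cap_neq_Top] by blast
    then show ?thesis using cap_mono[of "cap N s" y N] True by (intro bexI[of _ y])
        (cases y; auto simp: less_eq_tie_elem_def)+
  next
    case False
    then show ?thesis using tie_compact[OF A order_refl] cap_mono by blast
  qed
  moreover have "cap N y \<le> cap N s" if "y \<in> A" for y
    using that s(2) cap_mono by blast
  ultimately have "isLub plotkin_tie (cap N ` A) (cap N s)"
    using cl[OF s(1)] by (auto simp: isLub_iff intro: order_trans)
  moreover have "restrict (cap N) plotkin_tie ` A = cap N ` A"
    using A(1) by (auto simp: image_iff subset_iff)
  ultimately show "isLub plotkin_tie (restrict (cap N) plotkin_tie ` A)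
      (restrict (cap N) plotkin_tie s)"
    using s(1) by simp
qed (auto intro: cap_mono)

section \<open>Approximating maps into Plotkin's tie\<close>

text \<open>
  Finitely many comparisons, one for each separating element \<open>m\<close>, bound the approximant
  everywhere: \<open>cap N (g m)\<close> is a compact element below \<open>g m\<close>, so some single member \<open>k\<close> of a
  directed family with supremum above \<open>g\<close> satisfies \<open>cap N (g m) \<le> k m\<close> for all \<open>m\<close>.
\<close>

lemma capped_approximant_way_below:
  assumes f: "f \<in> scott_space D D" "finitely_separated D f"
    and g: "g \<in> scott_space D plotkin_tie"
  obtains N0 where
    "\<And>N. N \<ge> N0 \<Longrightarrow> way_below (scott_space D plotkin_tie) (\<lambda>x\<in>D. cap N (g (f x))) g"
proof -
  obtain M where M: "M \<subseteq> D" "finite M" "\<And>x. x \<in> D \<Longrightarrow> \<exists>m\<in>M. f x \<le> m \<and> m \<le> x"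
    using f(2) unfolding finitely_separated_def by blast
  have "\<forall>m. \<exists>N0. \<forall>N\<ge>N0. cap N (g m) \<le> g m"
    using cap_eventually_le by blast
  from choice[OF this] obtain b where b: "\<And>m N. N \<ge> b m \<Longrightarrow> cap N (g m) \<le> g m"
    by blast
  have "\<exists>N0. \<forall>m\<in>M. b m \<le> N0"
    using M(2) by (metis finite_imageI finite_nat_set_iff_bounded_le imageI)
  then obtain N0 where N0: "\<And>m. m \<in> M \<Longrightarrow> b m \<le> N0" by blast
  show thesis
  proof (rule that)
    fix N assume "N \<ge> N0"
    let ?h = "\<lambda>x\<in>D. cap N (g (f x))"
    have "?h = restrict (\<lambda>x. restrict (cap N) plotkin_tie
        (restrict (\<lambda>x. g (f x)) D x)) D"
      using scott_space_closed[OF g] scott_space_closed[OF f(1)] by (auto simp: fun_eq_iff)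
    then have h: "?h \<in> scott_space D plotkin_tie"
      using scott_space_compose[OF cap_scott_space scott_space_compose[OF g f(1)]] by simp
    show "way_below (scott_space D plotkin_tie) ?h g"
      unfolding way_below_def
    proof (intro conjI allI impI h g)
      fix K s
      assume "K \<subseteq> scott_space D plotkin_tie \<and> directed K \<and>
        isLub (scott_space D plotkin_tie) K s \<and> g \<le> s"
      then have K: "K \<subseteq> scott_space D plotkin_tie" "directed K"
        "isLub (scott_space D plotkin_tie) K s" "g \<le> s" by auto
      have "\<exists>k\<in>K. \<forall>m\<in>M. cap N (g m) \<le> k m"
      proof (rule directed_finite_choice[OF K(2) M(2)])
        fix m assume m: "m \<in> M"
        have "cap N (g m) \<le> g m" using b N0[OF m] \<open>N \<ge> N0\<close> by simp
        also have "\<dots> \<le> s m" using K(4) by (rule le_funD)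
        finally have le: "cap N (g m) \<le> s m" .
        have "m \<in> D" using m M(1) by blast
        have sub: "(\<lambda>k. k m) ` K \<subseteq> plotkin_tie"
          using K(1) \<open>m \<in> D\<close> scott_space_closed by blast
        show "\<exists>k\<in>K. cap N (g m) \<le> k m"
          using tie_compact[OF sub directed_eval[OF K(2)]
              isLub_scott_spaceD[OF dcpo_plotkin_tie K(1-3) \<open>m \<in> D\<close>] le cap_neq_Top] by blast
      next
        show "cap N (g m) \<le> l m" if "cap N (g m) \<le> k m" "k \<le> l" for m k l
          using that by (meson le_funD order_trans)
      qed
      then obtain k where k: "k \<in> K" "\<And>m. m \<in> M \<Longrightarrow> cap N (g m) \<le> k m" by blast
      have kS: "k \<in> scott_space D plotkin_tie" using k(1) K(1) by blast
      have "cap N (g (f x)) \<le> k x" if x: "x \<in> D" for x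
      proof -
        obtain m where m: "m \<in> M" "f x \<le> m" "m \<le> x" using M(3)[OF x] by blast
        have "m \<in> D" using m(1) M(1) by blast
        have "cap N (g (f x)) \<le> cap N (g m)"
          using cap_mono scott_space_mono[OF g] scott_space_closed[OF f(1) x] \<open>m \<in> D\<close> m(2)
          by blast
        also have "\<dots> \<le> k m" using k(2) m(1) .
        also have "\<dots> \<le> k x" using scott_space_mono[OF kS] \<open>m \<in> D\<close> x m(3) .
        finally show ?thesis .
      qed
      then have "?h \<le> k" using h kS by (simp add: scott_space_le_iff)
      then show "\<exists>k\<in>K. ?h \<le> k" using k(1) by blast
    qed
  qed
qed

lemma isLub_precompose_approximate_identity:
  assumes F: "F \<subseteq> scott_space D D" "directed F" "\<And>x. x \<in> D \<Longrightarrow> isLub D ((\<lambda>f. f x) ` F) x"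
    and g: "g \<in> scott_space D E"
  shows "directed ((\<lambda>f. \<lambda>x\<in>D. g (f x)) ` F)"
    and "isLub (scott_space D E) ((\<lambda>f. \<lambda>x\<in>D. g (f x)) ` F) g"
proof -
  show "directed ((\<lambda>f. \<lambda>x\<in>D. g (f x)) ` F)"
  proof (rule directed_image[OF F(2)])
    fix f f' assume "f \<in> F" "f' \<in> F" "f \<le> f'"
    then have "g (f x) \<le> g (f' x)" if "x \<in> D" for x
      using that F(1) scott_space_closed scott_space_mono[OF g] by (meson le_funD subsetD)
    then show "(\<lambda>x\<in>D. g (f x)) \<le> (\<lambda>x\<in>D. g (f' x))" by (simp add: le_fun_def)
  qed
  show "isLub (scott_space D E) ((\<lambda>f. \<lambda>x\<in>D. g (f x)) ` F) g"
  proof (rule isLub_scott_spaceI[OF _ g])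
    show "(\<lambda>f. \<lambda>x\<in>D. g (f x)) ` F \<subseteq> scott_space D E"
      using F(1) scott_space_compose[OF g] by blast
    fix x assume x: "x \<in> D"
    have "(\<lambda>f. f x) ` F \<subseteq> D" using F(1) scott_space_closed x by blast
    then have "isLub E (g ` (\<lambda>f. f x) ` F) (g x)"
      using scott_space_isLub[OF g] directed_eval[OF F(2)] F(3)[OF x] by blast
    then show "isLub E ((\<lambda>h. h x) ` (\<lambda>f. \<lambda>x\<in>D. g (f x)) ` F) (g x)"
      using x by (simp add: image_image)
  qed
qed

theorem theorem5p7:
  fixes D :: "'a::order set"
  assumes "FS_domain D"
  shows "continuous_dcpo (scott_space D plotkin_tie)"
  unfolding continuous_dcpo_def
proof (intro conjI[OF dcpo_scott_space[OF dcpo_plotkin_tie]] ballI)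
  obtain F where F: "F \<subseteq> scott_space D D" "directed F"
      "\<And>x. x \<in> D \<Longrightarrow> isLub D ((\<lambda>f. f x) ` F) x"
    and sep: "\<And>f. f \<in> F \<Longrightarrow> finitely_separated D f"
    using assms unfolding FS_domain_def by blast
  let ?S = "scott_space D plotkin_tie"
  fix g assume g: "g \<in> ?S"
  let ?G = "(\<lambda>f. \<lambda>x\<in>D. g (f x)) ` F"
  note G = isLub_precompose_approximate_identity[OF F g]
  have G_sub: "?G \<subseteq> ?S" using F(1) scott_space_compose[OF g] by blast
  define h where "h N f = (\<lambda>x\<in>D. cap N (g (f x)))" for N f
  have ev: "\<exists>N0. \<forall>N\<ge>N0. way_below ?S (h N f) g" if f: "f \<in> F" for f
    using capped_approximant_way_below[OF subsetD[OF F(1) f] sep[OF f] g]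
    unfolding h_def by metis
  define H where "H = {h N f | N f. f \<in> F \<and> way_below ?S (h N f) g}"
  show "directed {a \<in> ?S. way_below ?S a g} \<and> isLub ?S {a \<in> ?S. way_below ?S a g} g"
  proof (rule directed_way_belowI[OF g])
    show "way_below ?S k g" if "k \<in> H" for k
      using that by (auto simp: H_def)
    show "directed H"
      unfolding directed_def
    proof (intro conjI ballI)
      obtain f where "f \<in> F" using F(2) by (auto simp: directed_def)
      then show "H \<noteq> {}" using ev[of f] unfolding H_def by blast
      fix k l assume "k \<in> H" "l \<in> H"
      then obtain N1 f1 N2 f2 where k: "k = h N1 f1" "way_below ?S k g"
        and l: "l = h N2 f2" "way_below ?S l g"
        unfolding H_def by blast
      have "\<exists>f\<in>F. k \<le> (\<lambda>x\<in>D. g (f x))" "\<exists>f\<in>F. l \<le> (\<lambda>x\<in>D. g (f x))"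
        using k(2) l(2) G G_sub unfolding way_below_def by blast+
      then obtain f where f: "f \<in> F" "k \<le> (\<lambda>x\<in>D. g (f x))" "l \<le> (\<lambda>x\<in>D. g (f x))"
        using G(1) unfolding directed_def by (smt (verit) image_iff order_trans)
      obtain N0 where N0: "\<forall>N\<ge>N0. way_below ?S (h N f) g" using ev f(1) by blast
      \<comment> \<open>\<open>N1\<close> and \<open>N2\<close> must be exceeded strictly, as \<open>cap N1\<close> takes a value of index \<open>Suc N1\<close>.\<close>
      define N where "N = max N0 (Suc (max N1 N2))"
      have "h N' f' \<le> h N f" if "h N' f' \<le> (\<lambda>x\<in>D. g (f x))" "N' < N" for N' f'
      proof (rule le_funI)
        fix x
        show "h N' f' x \<le> h N f x"
        proof (cases "x \<in> D")
          case True
          have "cap N' (g (f' x)) \<le> g (f x)"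
            using le_funD[OF that(1), of x] True by (simp add: h_def)
          then show ?thesis
            using cap_mono[of _ _ N] cap_cap[OF that(2)] True by (metis h_def restrict_apply')
        qed (simp add: h_def)
      qed
      then have "k \<le> h N f" "l \<le> h N f" using f k l by (auto simp: N_def)
      moreover have "h N f \<in> H"
        using f(1) N0[rule_format, of N] max.cobounded1[of N0] unfolding H_def N_def by blast
      ultimately show "\<exists>z\<in>H. k \<le> z \<and> l \<le> z" by blast
    qed
    show "isLub ?S H g"
      unfolding isLub_iff
    proof (intro conjI ballI impI g)
      show "k \<le> g" if "k \<in> H" for k
        using that way_below_imp_le by (auto simp: H_def)
      fix u assume u: "u \<in> ?S" "\<forall>k\<in>H. k \<le> u"
      have "(\<lambda>x\<in>D. g (f x)) \<le> u" if f: "f \<in> F" for f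
      proof -
        obtain N0 where N0: "\<forall>N\<ge>N0. way_below ?S (h N f) g" using ev f by blast
        have "g (f x) \<le> u x" if x: "x \<in> D" for x
        proof (rule le_if_cap_le)
          fix N assume "N \<ge> N0"
          then have "h N f \<le> u" using N0 f u(2) by (auto simp: H_def)
          then show "cap N (g (f x)) \<le> u x" using x by (auto simp: h_def dest: le_funD[of _ _ x])
        qed
        moreover have "(\<lambda>x\<in>D. g (f x)) \<in> ?S" using G_sub f by blast
        ultimately show ?thesis using u(1) by (simp add: scott_space_le_iff)
      qed
      then show "g \<le> u" using G(2) u(1) by (auto simp: isLub_iff)
    qed
  qed
qed

end
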